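(* The spaces $(\rho',{\cal BH}^+/{\cal I}'_0)$ and $(\rho',{\cal BH}^-/{\cal I}'_0)$ do not have $\mathfrak u(2,2)$-invariant unitary structures.
   Context: $\mathbb H_{\mathbb C}=\mathbb C\otimes_{\mathbb R}\mathbb H$ is identified with $2\times2$ complex matrices $Z=\bigl(\begin{smallmatrix} z_{11}&z_{12}\\ z_{21}&z_{22}\end{smallmatrix}\bigr)$, $N(Z)=\det Z$. For $l=0,\frac12,1,\dots$ and $m,n\in\mathbb Z+l$, $-l\le m,n\le l$, $$t^l_{n\,\underline{m}}(Z)=\frac1{2\pi i}\oint (sz_{11}+z_{21})^{l-m}(sz_{12}+z_{22})^{l+m}s^{-l+n}\,\frac{ds}s$$ (counterclockwise loop around $0$). Inside $\mathbb C[z_{11},z_{12},z_{21},z_{22},N(Z)^{-1}]$, let ${\cal BH}^+=\mathbb C\text{-span}\{N(Z)^kt^l_{n\,\underline m}(Z);\ 0\le k\le1\}$, ${\cal BH}^-=\mathbb C\text{-span}\{N(Z)^kt^l_{n\,\underline m}(Z);\ -1\le 2l+k\le0\}$ (spaces of biharmonic functions), and let ${\cal I}'_0=\mathbb C$ be the constants, contained in both. $\mathfrak{gl}(2,\mathbb H_{\mathbb C})\simeq\mathfrak{gl}(4,\mathbb C)$ acts on these spaces by $\rho'$, obtained by differentiating $(\rho'(h)f)(Z)=f\bigl((aZ+b)(cZ+d)^{-1}\bigr)$, $h^{-1}=\bigl(\begin{smallmatrix}a&b\\ c&d\end{smallmatrix}\bigr)\in GL(2,\mathbb H_{\mathbb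 C})$. $\mathfrak u(2,2)=\bigl\{\bigl(\begin{smallmatrix}A&B\\ B^*&D\end{smallmatrix}\bigr);A,B,D\in\mathbb H_{\mathbb C},A=-A^*,D=-D^*\bigr\}$. A $\mathfrak u(2,2)$-invariant unitary structure is a positive definite Hermitian inner product $(\cdot,\cdot)$ with $(\rho'(X)\phi_1,\phi_2)+(\phi_1,\rho'(X)\phi_2)=0$ for all $X\in\mathfrak u(2,2)$. *)

theory Defs
  imports
    "HOL-Complex_Analysis.Complex_Analysis"
    "HOL-Library.Function_Algebras"
    "HOL-Library.Set_Algebras"
begin

type_synonym HC = "complex^2^2"

type_synonym gl2HC = "complex^(2 + 2)^(2 + 2)"

text \<open>
  The algebra of polynomials in the entries of \<open>Z\<close> with the inverse of \<open>N(Z) = det Z\<close> adjoined is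
  realised as an algebra of functions on the set where \<open>det Z \<noteq> 0\<close>. Such a function is represented
  by the total function that is \<open>0\<close> at every singular matrix, so that equality of total functions is
  equality on the invertible matrices.
\<close>

definition on_GL :: "(HC \<Rightarrow> complex) \<Rightarrow> HC \<Rightarrow> complex" where
  "on_GL f = (\<lambda>Z. if det Z \<noteq> 0 then f Z else 0)"

definition scale_fun :: "complex \<Rightarrow> ('a \<Rightarrow> complex) \<Rightarrow> 'a \<Rightarrow> complex" where
  "scale_fun c f = (\<lambda>x. c * f x)"

interpretation cfun: vector_space "scale_fun :: complex \<Rightarrow> ('a \<Rightarrow> complex) \<Rightarrow> 'a \<Rightarrow> complex"
  by unfold_locales (auto simp: scale_fun_def fun_eq_iff algebra_simps)

definition half_index :: "real \<Rightarrow> real \<Rightarrow> real \<Rightarrow> bool" where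
  "half_index l m n \<longleftrightarrow>
     (\<exists>d::nat. l = real d / 2) \<and> m - l \<in> \<int> \<and> n - l \<in> \<int> \<and>
     - l \<le> m \<and> m \<le> l \<and> - l \<le> n \<and> n \<le> l"

text \<open>
  The arguments are ordered \<open>l\<close>, \<open>n\<close>, \<open>m\<close>. Under \<open>half_index l m n\<close> the numbers below are
  integers, the first two nonnegative, so that the floors do not round. The integrand is
  holomorphic away from \<open>0\<close>, and the loop is taken to be the unit circle.
\<close>

definition tfun :: "real \<Rightarrow> real \<Rightarrow> real \<Rightarrow> HC \<Rightarrow> complex" where
  "tfun l n m Z =
     1 / (2 * of_real pi * \<i>) *
     contour_integral (circlepath 0 1)
       (\<lambda>s. (s * Z$1$1 + Z$2$1) ^ nat \<lfloor>l - m\<rfloor> * (s * Z$1$2 + Z$2$2) ^ nat \<lfloor>l + m\<rfloor>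
            * (s powi \<lfloor>- l + n\<rfloor>) / s)"

definition BH_plus :: "(HC \<Rightarrow> complex) set" where
  "BH_plus = cfun.span
     {on_GL (\<lambda>Z. (det Z powi k) * tfun l n m Z) | k l n m.
        half_index l m n \<and> 0 \<le> k \<and> k \<le> 1}"

definition BH_minus :: "(HC \<Rightarrow> complex) set" where
  "BH_minus = cfun.span
     {on_GL (\<lambda>Z. (det Z powi k) * tfun l n m Z) | k l n m.
        half_index l m n \<and> - 1 \<le> 2 * l + of_int k \<and> 2 * l + of_int k \<le> 0}"

definition I0' :: "(HC \<Rightarrow> complex) set" where
  "I0' = {on_GL (\<lambda>Z. c) | c. True}"

definition block :: "HC \<Rightarrow> HC \<Rightarrow> HC \<Rightarrow> HC \<Rightarrow> gl2HC" where
  "block a b c d = (\<chi> i j. case i of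
       Inl p \<Rightarrow> (case j of Inl q \<Rightarrow> a$p$q | Inr q \<Rightarrow> b$p$q)
     | Inr p \<Rightarrow> (case j of Inl q \<Rightarrow> c$p$q | Inr q \<Rightarrow> d$p$q))"

definition blk_a :: "gl2HC \<Rightarrow> HC" where "blk_a h = (\<chi> p q. h $ Inl p $ Inl q)"
definition blk_b :: "gl2HC \<Rightarrow> HC" where "blk_b h = (\<chi> p q. h $ Inl p $ Inr q)"
definition blk_c :: "gl2HC \<Rightarrow> HC" where "blk_c h = (\<chi> p q. h $ Inr p $ Inl q)"
definition blk_d :: "gl2HC \<Rightarrow> HC" where "blk_d h = (\<chi> p q. h $ Inr p $ Inr q)"

definition rho'_group :: "gl2HC \<Rightarrow> (HC \<Rightarrow> complex) \<Rightarrow> HC \<Rightarrow> complex" where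
  "rho'_group h f Z =
     (let g = matrix_inv h
      in f ((blk_a g ** Z + blk_b g) ** matrix_inv (blk_c g ** Z + blk_d g)))"

text \<open>
  The Lie algebra action is the differential at the identity, in the direction \<open>X\<close>, of the group
  action. For invertible \<open>Z\<close> and \<open>h\<close> near the identity, all the matrix inverses in the group action
  exist and \<open>f\<close> is evaluated at an invertible matrix.
\<close>

definition rho' :: "gl2HC \<Rightarrow> (HC \<Rightarrow> complex) \<Rightarrow> HC \<Rightarrow> complex" where
  "rho' X f = on_GL (\<lambda>Z. frechet_derivative (\<lambda>h. rho'_group h f Z) (at (mat 1)) X)"

definition conj_transpose :: "HC \<Rightarrow> HC" where
  "conj_transpose A = (\<chi> i j. cnj (A $ j $ i))"

definition u22 :: "gl2HC set" where
  "u22 = {block A B (conj_transpose B) D | A B D.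
            A = - conj_transpose A \<and> D = - conj_transpose D}"

text \<open>
  \<open>V/W\<close> is the set of cosets \<open>f +o W\<close> with \<open>f \<in> V\<close>; its vector space operations and the action of
  \<open>\<rho>'\<close> on it are the ones induced on cosets by the operations on representatives.
\<close>

definition hermitian_inner_product_quot ::
    "('a \<Rightarrow> complex) set \<Rightarrow> ('a \<Rightarrow> complex) set \<Rightarrow>
     (('a \<Rightarrow> complex) set \<Rightarrow> ('a \<Rightarrow> complex) set \<Rightarrow> complex) \<Rightarrow> bool" where
  "hermitian_inner_product_quot V W H \<longleftrightarrow>
     (\<forall>f\<in>V. \<forall>g\<in>V. \<forall>h\<in>V. H ((f + g) +o W) (h +o W) = H (f +o W) (h +o W) + H (g +o W) (h +o W)) \<and>
     (\<forall>c. \<forall>f\<in>V. \<forall>g\<in>V. H (scale_fun c f +o W) (g +o W) = c * H (f +o W) (g +o W)) \<and>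
     (\<forall>f\<in>V. \<forall>g\<in>V. H (g +o W) (f +o W) = cnj (H (f +o W) (g +o W))) \<and>
     (\<forall>f\<in>V. f +o W \<noteq> W \<longrightarrow> Re (H (f +o W) (f +o W)) > 0)"

definition u22_unitary_structure_quot ::
    "(HC \<Rightarrow> complex) set \<Rightarrow> (HC \<Rightarrow> complex) set \<Rightarrow>
     ((HC \<Rightarrow> complex) set \<Rightarrow> (HC \<Rightarrow> complex) set \<Rightarrow> complex) \<Rightarrow> bool" where
  "u22_unitary_structure_quot V W H \<longleftrightarrow>
     hermitian_inner_product_quot V W H \<and>
     (\<forall>X\<in>u22. \<forall>f\<in>V. \<forall>g\<in>V.
        H (rho' X f +o W) (g +o W) + H (f +o W) (rho' X g +o W) = 0)"

end

theory Submission
  imports Defs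
begin

text \<open>
  Write \<open>E\<close> for the matrix unit with entry \<open>1\<close> in position \<open>(1,1)\<close>. The infinitesimal action is
  \<open>\<rho>'(X) f (Z) = df\<^sub>Z (ZCZ + ZD - AZ - B)\<close> for \<open>X\<close> with blocks \<open>A, B, C, D\<close>
  (lemma \<open>has_derivative_rho'_group\<close>), so the elements \<open>boost c\<close> of \<open>u(2,2)\<close>, with \<open>A = D = 0\<close>,
  \<open>B = c E\<close> and \<open>C = cnj c E\<close>, move \<open>Z\<close> in the direction \<open>cnj c ZEZ - c E\<close>. The first summand
  raises the degree of a polynomial, the second lowers it. Invariance under \<open>boost 1\<close> and
  \<open>boost \<i>\<close> together forces the raising and the lowering operator to be, up to sign, adjoint to each
  other.

  In the polynomial space, take \<open>f = z\<^sub>2\<^sub>2\<close>. Raising gives \<open>q = z\<^sub>1\<^sub>2 z\<^sub>2\<^sub>1\<close>, and lowering takes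
  \<open>q\<close> to its derivative in \<open>z\<^sub>1\<^sub>1\<close>, which is \<open>0\<close>. Hence the square norm of \<open>q\<close>
  would be, up to sign, the inner product of \<open>f\<close> with \<open>0\<close>. Since \<open>q\<close> is not constant, this
  contradicts positivity.

  The inversion \<open>Z \<mapsto> Z\<inverse>\<close> carries the first space to the second and each \<open>boost\<close> to another one, so
  the same argument works there with \<open>f\<close> and \<open>q\<close> composed with the inversion: the functions are
  \<open>z\<^sub>1\<^sub>1 / N\<close> and \<open>z\<^sub>1\<^sub>2 z\<^sub>2\<^sub>1 / N\<^sup>2\<close>. The common Hermitian argument is the lemma
  \<open>isotropic_raised_vector\<close>. The functions are found in the spaces by reading the integrals
  \<open>t\<^sup>l\<close> as polynomial coefficients (lemma \<open>tfun_eq_coeff\<close>).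
\<close>

(* Power series coefficients and vector components share an infix symbol, and every product of
   matrix entries would otherwise have exponentially many parse trees. *)
no_notation fps_nth (infixl "$" 75)

section \<open>The Hermitian obstruction\<close>

text \<open>
  The elements \<open>X\<close> and \<open>Y\<close> stand for \<open>boost 1\<close> and \<open>boost \<i>\<close>, and \<open>r\<close> is \<open>q\<close> raised once more. On \<open>f\<close> and \<open>q\<close> they act
  by multiples of the same vectors because the lowering operator kills both. Invariance under \<open>X\<close> says
  that the square norm of \<open>q\<close> is minus the inner product of \<open>f\<close> and \<open>r\<close>. For \<open>Y\<close> the factor
  \<open>e\<close> appears once linearly and once conjugated, and as \<open>e\<close> is imaginary the sign
  flips. So \<open>q\<close> has square norm \<open>0\<close> and must vanish in the quotient.
\<close>
lemma isotropic_raised_vector: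
  assumes H: "u22_unitary_structure_quot V W H"
    and V: "cfun.subspace V" "f \<in> V" "q \<in> V" "r \<in> V"
    and XY: "X \<in> u22" "Y \<in> u22"
    and X: "rho' X f = q" "rho' X q = r"
    and Y: "rho' Y f = scale_fun e q" "rho' Y q = scale_fun e r"
    and e: "e \<noteq> 0" "cnj e = - e"
  shows "q +o W = W"
proof (rule ccontr)
  assume nz: "q +o W \<noteq> W"
  define B where "B g h = H (g +o W) (h +o W)" for g h
  have inv: "B (rho' T g) h + B g (rho' T h) = 0" if "T \<in> u22" "g \<in> V" "h \<in> V" for T g h
    using H that by (auto simp: u22_unitary_structure_quot_def B_def)
  have herm: "hermitian_inner_product_quot V W H"
    using H by (simp add: u22_unitary_structure_quot_def)
  have scale: "B (scale_fun c g) h = c * B g h" and conj_sym: "B h g = cnj (B g h)"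
    if "g \<in> V" "h \<in> V" for c g h
    using herm that unfolding hermitian_inner_product_quot_def B_def by blast+
  have pos: "Re (B q q) > 0"
    using herm V nz unfolding hermitian_inner_product_quot_def B_def by blast
  have er: "scale_fun e r \<in> V"
    using V by (simp add: cfun.subspace_scale)
  have "B f (scale_fun e r) = cnj (B (scale_fun e r) f)"
    using conj_sym[OF er V(2)] .
  also have "\<dots> = - e * B f r"
    using V e scale[of r f e] conj_sym[of r f] by simp
  finally have "e * B q q - e * B f r = 0"
    using inv[of Y f q] XY V Y scale[of q q e] by simp
  then have "B q q = B f r"
    using e by simp
  moreover have "B q q + B f r = 0"
    using inv[of X f q] XY V X by simp
  ultimately have "B q q = 0"
    by simp
  with pos show False by simp
qed

section \<open>Differentiating the group action\<close>

lemma has_derivative_vec_iff: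
  fixes f :: "'a::real_normed_vector \<Rightarrow> 'b::euclidean_space^'n"
  shows "(f has_derivative f') (at x) \<longleftrightarrow>
    (\<forall>i. ((\<lambda>x. f x $ i) has_derivative (\<lambda>h. f' h $ i)) (at x))"
proof
  assume "(f has_derivative f') (at x)"
  then show "\<forall>i. ((\<lambda>x. f x $ i) has_derivative (\<lambda>h. f' h $ i)) (at x)"
    using bounded_linear.has_derivative[OF bounded_linear_vec_nth] by blast
next
  assume *: "\<forall>i. ((\<lambda>x. f x $ i) has_derivative (\<lambda>h. f' h $ i)) (at x)"
  show "(f has_derivative f') (at x)"
    unfolding has_derivative_componentwise_within[of f]
  proof
    fix b :: "'b^'n"
    assume "b \<in> Basis"
    then obtain i u where "b = axis i u"
      by (auto simp: Basis_vec_def)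
    then show "((\<lambda>x. f x \<bullet> b) has_derivative (\<lambda>h. f' h \<bullet> b)) (at x)"
      using has_derivative_inner_left[OF *[rule_format], of i u] by (simp add: inner_axis)
  qed
qed

lemma has_derivative_mat_iff:
  fixes f :: "'a::real_normed_vector \<Rightarrow> 'b::euclidean_space^'n^'m"
  shows "(f has_derivative f') (at x) \<longleftrightarrow>
    (\<forall>i j. ((\<lambda>x. f x $ i $ j) has_derivative (\<lambda>h. f' h $ i $ j)) (at x))"
  by (simp add: has_derivative_vec_iff)

lemma has_derivative_matrix_mult:
  fixes f :: "'a::real_normed_vector \<Rightarrow> complex^'n^'m" and g :: "'a \<Rightarrow> complex^'k^'n"
  assumes "(f has_derivative f') (at x)" and "(g has_derivative g') (at x)"
  shows "((\<lambda>x. f x ** g x) has_derivative (\<lambda>h. f x ** g' h + f' h ** g x)) (at x)"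
  unfolding has_derivative_mat_iff
proof (intro allI)
  fix i j
  have "((\<lambda>x. f x $ i $ k) has_derivative (\<lambda>h. f' h $ i $ k)) (at x)"
       "((\<lambda>x. g x $ k $ j) has_derivative (\<lambda>h. g' h $ k $ j)) (at x)" for k
    using assms by (auto simp: has_derivative_mat_iff)
  then show "((\<lambda>x. (f x ** g x) $ i $ j) has_derivative
      (\<lambda>h. (f x ** g' h + f' h ** g x) $ i $ j)) (at x)"
    by (simp add: matrix_matrix_mult_def sum.distrib[symmetric])
       (auto intro!: derivative_eq_intros)
qed

lemma differentiable_prod:
  fixes f :: "'i \<Rightarrow> 'a::real_normed_vector \<Rightarrow> complex"
  assumes "\<And>i. i \<in> I \<Longrightarrow> f i differentiable at x"
  shows "(\<lambda>x. \<Prod>i\<in>I. f i x) differentiable at x"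
  using assms by (induction I rule: infinite_finite_induct) (auto intro!: differentiable_mult)

lemma differentiable_det:
  fixes M :: "'a::real_normed_vector \<Rightarrow> complex^'n^'n"
  assumes "\<And>i j. (\<lambda>x. M x $ i $ j) differentiable at x"
  shows "(\<lambda>x. det (M x)) differentiable at x"
  unfolding det_def
  by (intro differentiable_sum differentiable_mult differentiable_const)
     (auto simp: finite_permutations intro!: differentiable_prod assms)

lemma matrix_inv_right:
  fixes A :: "complex^'n^'n"
  assumes "det A \<noteq> 0"
  shows "A ** matrix_inv A = mat 1"
proof -
  have "\<exists>B. A ** B = mat 1 \<and> B ** A = mat 1"
    using assms invertible_det_nz[of A] by (simp add: invertible_def)
  from someI_ex[OF this] show ?thesis
    by (simp add: matrix_inv_def)
qed

text \<open>
  Cramer's rule, applied to the columns of the inverse. It exhibits every entry of the inverse as a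
  quotient of polynomials in the entries of the matrix, which is what makes inversion differentiable.
\<close>
lemma matrix_inv_component:
  fixes A :: "complex^'n^'n"
  assumes "det A \<noteq> 0"
  shows "matrix_inv A $ i $ j = det (\<chi> r c. if c = i then axis j 1 $ r else A $ r $ c) / det A"
proof -
  have "A *v (matrix_inv A *v axis j 1) = axis j 1"
    using matrix_inv_right[OF assms] by (simp add: matrix_vector_mul_assoc)
  then have "matrix_inv A *v axis j 1 =
      (\<chi> i. det (\<chi> r c. if c = i then axis j 1 $ r else A $ r $ c) / det A)"
    by (simp only: cramer[OF assms])
  then have "(matrix_inv A *v axis j 1) $ i =
      det (\<chi> r c. if c = i then axis j 1 $ r else A $ r $ c) / det A"
    by simp
  then show ?thesis
    by (simp add: matrix_vector_mult_def axis_def if_distrib[of "(*) _"] cong: if_cong)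
qed

lemma has_derivative_entry [derivative_intros]:
  "((\<lambda>A :: complex^'n^'m. A $ i $ j) has_derivative (\<lambda>X. X $ i $ j)) (at A)"
  using has_derivative_mat_iff[of "\<lambda>A. A" "\<lambda>X. X" A] by simp

lemma eventually_det_nonzero:
  fixes A :: "complex^'n^'n"
  assumes "det A \<noteq> 0"
  shows "\<forall>\<^sub>F B in at A. det B \<noteq> 0"
proof -
  have "(\<lambda>B :: complex^'n^'n. det B) differentiable at A"
    by (rule differentiable_det) (auto intro: differentiableI has_derivative_entry)
  then have "isCont (\<lambda>B. det B) A"
    by (rule differentiable_imp_continuous_within)
  then show ?thesis
    using assms by (intro tendsto_imp_eventually_ne) (auto simp: isCont_def)
qed

text \<open>
  Once the inverse is known to be differentiable, its derivative at the identity is read off by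
  differentiating \<open>A A\<inverse> = 1\<close>.
\<close>
lemma has_derivative_matrix_inv:
  "((matrix_inv :: complex^'n^'n \<Rightarrow> complex^'n^'n) has_derivative uminus) (at (mat 1))"
proof -
  let ?inv = "matrix_inv :: complex^'n^'n \<Rightarrow> complex^'n^'n"
  have det1: "det (mat 1 :: complex^'n^'n) \<noteq> 0"
    by simp
  have inv1: "?inv (mat 1) = mat 1"
    using matrix_inv_right[OF det1] by simp
  have ev: "\<forall>\<^sub>F A :: complex^'n^'n in at (mat 1). det A \<noteq> 0"
    by (rule eventually_det_nonzero[OF det1])
  have "\<exists>D. ((\<lambda>A. ?inv A $ i $ j) has_derivative D) (at (mat 1))" for i j
  proof -
    have "(\<lambda>A :: complex^'n^'n. (\<chi> r c. if c = i then axis j 1 $ r else A $ r $ c) $ r $ c)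
        differentiable at (mat 1)" for r c
      by (cases "c = i") (auto intro: differentiableI has_derivative_entry)
    moreover have "(\<lambda>A :: complex^'n^'n. A $ r $ c) differentiable at (mat 1)" for r c
      by (auto intro: differentiableI has_derivative_entry)
    ultimately have "(\<lambda>A :: complex^'n^'n.
        det (\<chi> r c. if c = i then axis j 1 $ r else A $ r $ c) / det A) differentiable at (mat 1)"
      by (intro differentiable_divide differentiable_det det1)
    then obtain D where "((\<lambda>A :: complex^'n^'n.
        det (\<chi> r c. if c = i then axis j 1 $ r else A $ r $ c) / det A) has_derivative D) (at (mat 1))"
      by (auto simp: differentiable_def)
    moreover have "\<forall>\<^sub>F A :: complex^'n^'n in at (mat 1).
        det (\<chi> r c. if c = i then axis j 1 $ r else A $ r $ c) / det A = ?inv A $ i $ j"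
      using ev by eventually_elim (simp add: matrix_inv_component)
    ultimately have "((\<lambda>A. ?inv A $ i $ j) has_derivative D) (at (mat 1))"
      by (rule has_derivative_transform_eventually)
         (use matrix_inv_component[OF det1, of i j] in simp_all)
    then show ?thesis by blast
  qed
  then obtain D where "\<And>i j. ((\<lambda>A. ?inv A $ i $ j) has_derivative D i j) (at (mat 1))"
    by metis
  then have D: "(?inv has_derivative (\<lambda>X. \<chi> i j. D i j X)) (at (mat 1))"
    by (simp add: has_derivative_mat_iff)
  have "((\<lambda>A. A ** ?inv A) has_derivative (\<lambda>X. (\<chi> i j. D i j X) + X)) (at (mat 1))"
    using has_derivative_matrix_mult[OF has_derivative_ident D] by (simp add: inv1)
  moreover have "((\<lambda>A. A ** ?inv A) has_derivative (\<lambda>X. 0)) (at (mat 1))"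
    by (rule has_derivative_transform_eventually[OF has_derivative_const[of "mat 1"]])
       (use ev in eventually_elim, simp_all add: matrix_inv_right inv1)
  ultimately have "(\<lambda>X. (\<chi> i j. D i j X) + X) = (\<lambda>X. 0)"
    by (rule has_derivative_unique)
  then have "(\<lambda>X. \<chi> i j. D i j X) = uminus"
    unfolding fun_eq_iff eq_neg_iff_add_eq_0 .
  with D show ?thesis by simp
qed

lemma blk_block [simp]:
  "blk_a (block a b c d) = a" "blk_b (block a b c d) = b"
  "blk_c (block a b c d) = c" "blk_d (block a b c d) = d"
  by (simp_all add: blk_a_def blk_b_def blk_c_def blk_d_def block_def vec_eq_iff)

lemma blk_mat_1:
  "blk_a (mat 1) = mat 1" "blk_b (mat 1) = 0" "blk_c (mat 1) = 0" "blk_d (mat 1) = mat 1"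
  by (simp_all add: blk_a_def blk_b_def blk_c_def blk_d_def mat_def vec_eq_iff)

text \<open>
  To first order the inverse of \<open>1 + X\<close> is \<open>1 - X\<close>, so \<open>Z\<close> is moved to
  \<open>(Z - AZ - B)(1 - CZ - D)\<inverse>\<close>, and \<open>CZ + D\<close> in the denominator is again inverted at the
  identity. The derivative of inversion at the identity is therefore enough for both inverses, of sizes
  four and two.
\<close>
lemma has_derivative_rho'_group:
  assumes "(f has_derivative f') (at Z)"
  shows "((\<lambda>h. rho'_group h f Z) has_derivative
    (\<lambda>X. f' (Z ** blk_c X ** Z + Z ** blk_d X - blk_a X ** Z - blk_b X))) (at (mat 1))"
proof -
  let ?inv = "matrix_inv :: gl2HC \<Rightarrow> gl2HC"
  have inv1: "matrix_inv (mat 1 :: complex^'n^'n) = mat 1"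
    using matrix_inv_right[of "mat 1 :: complex^'n^'n"] by simp
  have blk:
    "((\<lambda>h. blk_a (?inv h)) has_derivative (\<lambda>X. - blk_a X)) (at (mat 1))"
    "((\<lambda>h. blk_b (?inv h)) has_derivative (\<lambda>X. - blk_b X)) (at (mat 1))"
    "((\<lambda>h. blk_c (?inv h)) has_derivative (\<lambda>X. - blk_c X)) (at (mat 1))"
    "((\<lambda>h. blk_d (?inv h)) has_derivative (\<lambda>X. - blk_d X)) (at (mat 1))"
    using has_derivative_matrix_inv[where ?'n = "2 + 2"]
    by (simp_all add: has_derivative_mat_iff blk_a_def blk_b_def blk_c_def blk_d_def)
  have neg: "- P ** Q = - (P ** Q)" for P Q :: HC
    by (simp add: matrix_matrix_mult_def vec_eq_iff sum_negf)
  have linear_fractional: "((\<lambda>h. P h ** Z + Q h) has_derivative (\<lambda>X. P' X ** Z + Q' X)) (at (mat 1))"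
    if "(P has_derivative P') (at (mat 1))" "(Q has_derivative Q') (at (mat 1))"
    for P Q :: "gl2HC \<Rightarrow> HC" and P' Q'
    using has_derivative_add[OF has_derivative_matrix_mult[OF that(1) has_derivative_const[of Z]] that(2)]
    by simp
  have "(matrix_inv has_derivative uminus) (at (blk_c (?inv (mat 1)) ** Z + blk_d (?inv (mat 1))))"
    using has_derivative_matrix_inv[where ?'n = 2] by (simp add: inv1 blk_mat_1)
  note denominator_inv = has_derivative_compose[OF linear_fractional[OF blk(3,4)] this]
  have "((\<lambda>h. (blk_a (?inv h) ** Z + blk_b (?inv h)) **
        matrix_inv (blk_c (?inv h) ** Z + blk_d (?inv h))) has_derivative
      (\<lambda>X. Z ** blk_c X ** Z + Z ** blk_d X - blk_a X ** Z - blk_b X)) (at (mat 1))"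
    by (rule has_derivative_eq_rhs[OF has_derivative_matrix_mult
          [OF linear_fractional[OF blk(1,2)] denominator_inv]])
       (simp add: inv1 blk_mat_1 neg matrix_add_ldistrib matrix_mul_assoc fun_eq_iff)
  moreover have "(f has_derivative f') (at ((blk_a (?inv (mat 1)) ** Z + blk_b (?inv (mat 1))) **
        matrix_inv (blk_c (?inv (mat 1)) ** Z + blk_d (?inv (mat 1)))))"
    using assms by (simp add: inv1 blk_mat_1)
  ultimately show ?thesis
    unfolding rho'_group_def Let_def by (rule has_derivative_compose)
qed

lemma on_GL_cong: "(\<And>Z. det Z \<noteq> 0 \<Longrightarrow> g Z = h Z) \<Longrightarrow> on_GL g = on_GL h"
  by (simp add: on_GL_def fun_eq_iff)

lemma scale_fun_on_GL: "scale_fun c (on_GL g) = on_GL (\<lambda>Z. c * g Z)"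
  by (simp add: on_GL_def scale_fun_def fun_eq_iff)

lemma has_derivative_on_GL:
  assumes "(f has_derivative f') (at Z)" and "det Z \<noteq> 0"
  shows "(on_GL f has_derivative f') (at Z)"
proof (rule has_derivative_transform_eventually[OF assms(1)])
  show "\<forall>\<^sub>F W in at Z. f W = on_GL f W"
    using eventually_det_nonzero[OF assms(2)] by eventually_elim (simp add: on_GL_def)
qed (use assms(2) in \<open>simp_all add: on_GL_def\<close>)

lemma rho'_on_GL:
  assumes "\<And>Z. det Z \<noteq> 0 \<Longrightarrow> (f has_derivative f' Z) (at Z)"
  shows "rho' X (on_GL f) =
    on_GL (\<lambda>Z. f' Z (Z ** blk_c X ** Z + Z ** blk_d X - blk_a X ** Z - blk_b X))"
proof
  fix Z :: HC
  show "rho' X (on_GL f) Z =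
    on_GL (\<lambda>Z. f' Z (Z ** blk_c X ** Z + Z ** blk_d X - blk_a X ** Z - blk_b X)) Z"
  proof (cases "det Z = 0")
    case False
    have "((\<lambda>h. rho'_group h (on_GL f) Z) has_derivative
        (\<lambda>X. f' Z (Z ** blk_c X ** Z + Z ** blk_d X - blk_a X ** Z - blk_b X))) (at (mat 1))"
      using False assms by (intro has_derivative_rho'_group has_derivative_on_GL)
    note D = frechet_derivative_at[OF this, symmetric]
    have "on_GL g Z = g Z" for g
      using False by (simp add: on_GL_def)
    then show ?thesis
      by (simp add: rho'_def D)
  qed (simp add: rho'_def on_GL_def)
qed

section \<open>Two noncompact directions\<close>

definition unit11 :: "complex \<Rightarrow> HC" where
  "unit11 c = (\<chi> i j. if i = 1 \<and> j = 1 then c else 0)"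

text \<open>
  A real plane in the noncompact part of \<open>u(2,2)\<close>: the element is only real linear in \<open>c\<close>, so the
  values at \<open>1\<close> and \<open>\<i>\<close> carry independent information.
\<close>
definition boost :: "complex \<Rightarrow> gl2HC" where
  "boost c = block 0 (unit11 c) (unit11 (cnj c)) 0"

lemma boost_in_u22: "boost c \<in> u22"
proof -
  have "conj_transpose (unit11 c) = unit11 (cnj c)" and "(0 :: HC) = - conj_transpose 0"
    by (auto simp: conj_transpose_def unit11_def vec_eq_iff)
  then have "boost c = block 0 (unit11 c) (conj_transpose (unit11 c)) 0 \<and>
      (0 :: HC) = - conj_transpose 0 \<and> (0 :: HC) = - conj_transpose 0"
    by (simp add: boost_def)
  then show ?thesis
    unfolding u22_def by blast
qed

text \<open>
  The direction is \<open>cnj c ZEZ - c E\<close>, written out using \<open>(ZEZ)\<^sub>i\<^sub>j = z\<^sub>i\<^sub>1 z\<^sub>1\<^sub>j\<close>.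
\<close>
lemma rho'_boost:
  assumes "\<And>Z. det Z \<noteq> 0 \<Longrightarrow> (f has_derivative f' Z) (at Z)"
  shows "rho' (boost c) (on_GL f) =
    on_GL (\<lambda>Z. f' Z (\<chi> i j. cnj c * Z$i$1 * Z$1$j - unit11 c $ i $ j))"
proof -
  have "Z ** unit11 (cnj c) ** Z - unit11 c =
      (\<chi> i j. cnj c * Z$i$1 * Z$1$j - unit11 c $ i $ j)" for Z
    by (simp add: matrix_matrix_mult_def unit11_def vec_eq_iff sum_2 forall_2)
  then show ?thesis
    using rho'_on_GL[OF assms, where X = "boost c"] by (simp add: boost_def)
qed

text \<open>
  Neither function involves \<open>z\<^sub>1\<^sub>1\<close>, so the lowering summand \<open>- c E\<close> of the direction
  contributes nothing.
\<close>
lemma rho'_boost_plus: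
  "rho' (boost c) (on_GL (\<lambda>Z. Z$2$2)) = scale_fun (cnj c) (on_GL (\<lambda>Z. Z$1$2 * Z$2$1))"
  "rho' (boost c) (on_GL (\<lambda>Z. Z$1$2 * Z$2$1)) =
     scale_fun (cnj c) (on_GL (\<lambda>Z. 2 * Z$1$1 * Z$1$2 * Z$2$1))"
   apply (subst rho'_boost, (rule derivative_eq_intros refl)+)
   apply (simp add: on_GL_def scale_fun_def fun_eq_iff unit11_def algebra_simps)
  apply (subst rho'_boost, (rule derivative_eq_intros refl)+)
  apply (simp add: on_GL_def scale_fun_def fun_eq_iff unit11_def algebra_simps)
  done

text \<open>
  These functions depend on \<open>W = Z\<inverse>\<close> only, through \<open>w\<^sub>2\<^sub>2 = z\<^sub>1\<^sub>1 / N\<close>,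
  \<open>w\<^sub>1\<^sub>2 w\<^sub>2\<^sub>1 = z\<^sub>1\<^sub>2 z\<^sub>2\<^sub>1 / N\<^sup>2\<close> and
  \<open>w\<^sub>1\<^sub>1 = z\<^sub>2\<^sub>2 / N\<close>. If \<open>Z\<close> moves by \<open>cnj c ZEZ - c E\<close>, then
  \<open>W\<close> moves by \<open>c WEW - cnj c E\<close>: raising and lowering are exchanged, and the factor
  becomes \<open>c\<close> instead of its conjugate.
\<close>
lemma rho'_boost_minus:
  "rho' (boost c) (on_GL (\<lambda>Z. Z$1$1 / det Z)) =
     scale_fun c (on_GL (\<lambda>Z. Z$1$2 * Z$2$1 / det Z ^ 2))"
  "rho' (boost c) (on_GL (\<lambda>Z. Z$1$2 * Z$2$1 / det Z ^ 2)) =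
     scale_fun c (on_GL (\<lambda>Z. 2 * Z$2$2 * Z$1$2 * Z$2$1 / det Z ^ 3))"
proof -
  let ?N' = "\<lambda>Z X :: HC. X$1$1 * Z$2$2 + Z$1$1 * X$2$2 - (X$1$2 * Z$2$1 + Z$1$2 * X$2$1)"
  let ?dir = "\<lambda>Z. (\<chi> i j. cnj c * Z$i$1 * Z$1$j - unit11 c $ i $ j) :: HC"
  have N: "((\<lambda>Z :: HC. det Z) has_derivative ?N' Z) (at Z)" for Z
  proof -
    have "(\<lambda>Z :: HC. det Z) = (\<lambda>Z. Z$1$1 * Z$2$2 - Z$1$2 * Z$2$1)"
      by (simp add: fun_eq_iff det_2)
    moreover have "((\<lambda>Z :: HC. Z$1$1 * Z$2$2 - Z$1$2 * Z$2$1) has_derivative ?N' Z) (at Z)"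
      by (rule has_derivative_eq_rhs, (rule derivative_intros)+) (simp add: fun_eq_iff)
    ultimately show ?thesis by simp
  qed
  have N_dir: "?N' Z (?dir Z) = cnj c * Z$1$1 * det Z - c * Z$2$2" for Z
    by (simp add: det_2 unit11_def algebra_simps)
  have "((\<lambda>Z :: HC. Z$1$1 / det Z) has_derivative
      (\<lambda>X. (X$1$1 * det Z - Z$1$1 * ?N' Z X) / (det Z * det Z))) (at Z)" if "det Z \<noteq> 0" for Z
    by (rule has_derivative_divide'[OF has_derivative_entry N that])
  from rho'_boost[OF this, where c = c]
  show "rho' (boost c) (on_GL (\<lambda>Z. Z$1$1 / det Z)) =
     scale_fun c (on_GL (\<lambda>Z. Z$1$2 * Z$2$1 / det Z ^ 2))"
  proof (rule trans)
    have "(?dir Z $1$1 * det Z - Z$1$1 * ?N' Z (?dir Z)) / (det Z * det Z) =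
        c * (Z$1$2 * Z$2$1 / det Z ^ 2)" for Z
    proof -
      have "?dir Z $1$1 * det Z - Z$1$1 * ?N' Z (?dir Z) = c * (Z$1$1 * Z$2$2 - det Z)"
        unfolding N_dir by (simp add: unit11_def algebra_simps)
      also have "\<dots> = c * (Z$1$2 * Z$2$1)"
        by (simp add: det_2)
      finally show ?thesis
        by (simp only: power2_eq_square times_divide_eq_right)
    qed
    then show "on_GL (\<lambda>Z. (?dir Z $1$1 * det Z - Z$1$1 * ?N' Z (?dir Z)) / (det Z * det Z)) =
        scale_fun c (on_GL (\<lambda>Z. Z$1$2 * Z$2$1 / det Z ^ 2))"
      unfolding scale_fun_on_GL by (rule on_GL_cong)
  qed
  let ?q' = "\<lambda>Z X :: HC. ((Z$1$2 * X$2$1 + X$1$2 * Z$2$1) * det Z ^ 2 -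
      Z$1$2 * Z$2$1 * (of_nat 2 * ?N' Z X * det Z ^ (2 - 1))) / (det Z ^ 2 * det Z ^ 2)"
  have "((\<lambda>Z :: HC. Z$1$2 * Z$2$1 / det Z ^ 2) has_derivative ?q' Z) (at Z)"
    if "det Z \<noteq> 0" for Z
    by (intro has_derivative_divide' has_derivative_mult has_derivative_power has_derivative_entry N)
       (use that in simp)
  from rho'_boost[OF this, where c = c]
  show "rho' (boost c) (on_GL (\<lambda>Z. Z$1$2 * Z$2$1 / det Z ^ 2)) =
     scale_fun c (on_GL (\<lambda>Z. 2 * Z$2$2 * Z$1$2 * Z$2$1 / det Z ^ 3))"
  proof (rule trans)
    have "?q' Z (?dir Z) = c * (2 * Z$2$2 * Z$1$2 * Z$2$1 / det Z ^ 3)" if "det Z \<noteq> 0" for Z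
    proof -
      have "?q' Z (?dir Z) = (2 * c * Z$2$2 * Z$1$2 * Z$2$1 * det Z) / (det Z ^ 2 * det Z ^ 2)"
        unfolding N_dir by (simp add: unit11_def algebra_simps power2_eq_square)
      also have "\<dots> = c * (2 * Z$2$2 * Z$1$2 * Z$2$1 / det Z ^ 3)"
        using that by (simp add: power2_eq_square power3_eq_cube mult_ac)
      finally show ?thesis .
    qed
    then show "on_GL (\<lambda>Z. ?q' Z (?dir Z)) =
        scale_fun c (on_GL (\<lambda>Z. 2 * Z$2$2 * Z$1$2 * Z$2$1 / det Z ^ 3))"
      unfolding scale_fun_on_GL by (rule on_GL_cong)
  qed
qed

section \<open>The two spaces of biharmonic functions\<close>

text \<open>
  Cauchy's formula picks the coefficient of \<open>s\<^sup>k\<close> in the product of the two linear factors, where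
  \<open>a = l - m\<close>, \<open>b = l + m\<close> and \<open>k = l - n\<close>. In terms of \<open>a\<close>, \<open>b\<close> and \<open>k\<close> the admissible half-integral
  indices are exactly the natural numbers with \<open>k \<le> a + b\<close>.
\<close>
lemma tfun_eq_coeff:
  "tfun (real (a + b) / 2) (real (a + b) / 2 - real k) ((real b - real a) / 2) Z =
    poly.coeff ([:Z$2$1, Z$1$1:] ^ a * [:Z$2$2, Z$1$2:] ^ b) k"
proof -
  define p where "p = [:Z$2$1, Z$1$1:] ^ a * [:Z$2$2, Z$1$2:] ^ b"
  have "deriv (poly q) = poly (pderiv q)" for q :: "complex poly"
    by (rule ext) (rule DERIV_imp_deriv[OF poly_DERIV])
  then have "(deriv ^^ k) (poly p) = poly ((pderiv ^^ k) p)"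
    by (induction k) simp_all
  moreover have "poly.coeff ((pderiv ^^ k) p) 0 = fact k * poly.coeff p k"
    by (simp only: coeff_higher_pderiv pochhammer_fact) simp
  ultimately have taylor: "(deriv ^^ k) (poly p) 0 / fact k = poly.coeff p k"
    by (simp add: poly_0_coeff_0)
  have c: "contour_integral (circlepath 0 1) (\<lambda>s. poly p s / (s - 0) ^ Suc k) =
      2 * pi * \<i> * (deriv ^^ k) (poly p) 0 / fact k"
    by (rule Cauchy_contour_integral_circlepath) (auto intro!: continuous_intros holomorphic_intros)
  have f: "\<lfloor>real (a + b) / 2 - (real b - real a) / 2\<rfloor> = int a"
    "\<lfloor>real (a + b) / 2 + (real b - real a) / 2\<rfloor> = int b"
    "\<lfloor>- (real (a + b) / 2) + (real (a + b) / 2 - real k)\<rfloor> = - int k"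
    by (simp_all add: field_simps floor_eq_iff)
  have integrand: "(s * Z$1$1 + Z$2$1) ^ a * (s * Z$1$2 + Z$2$2) ^ b * (s powi (- int k)) / s
      = poly p s / (s - 0) ^ Suc k" for s
    by (simp add: p_def power_int_minus divide_inverse add.commute)
  then show ?thesis
    unfolding tfun_def f nat_int integrand c p_def[symmetric] taylor[symmetric]
    by simp
qed

lemma on_GL_combination:
  "on_GL (\<lambda>Z. c * g Z + d * h Z) = scale_fun c (on_GL g) + scale_fun d (on_GL h)"
  by (simp add: on_GL_def scale_fun_def fun_eq_iff)

lemma half_index_nat:
  assumes "k \<le> a + b"
  shows "half_index (real (a + b) / 2) ((real b - real a) / 2) (real (a + b) / 2 - real k)"
proof -
  have "(real b - real a) / 2 - real (a + b) / 2 = - of_nat a"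
    by (simp add: field_simps)
  moreover have "real k \<le> real (a + b)" using assms by (simp only: of_nat_le_iff)
  ultimately show ?thesis
    unfolding half_index_def by (auto simp: field_simps intro!: exI[of _ "a + b"])
qed

lemma BH_plus_generator:
  assumes "k \<le> a + b" and "0 \<le> j" and "j \<le> 1"
  shows "on_GL (\<lambda>Z. det Z powi j *
    poly.coeff ([:Z$2$1, Z$1$1:] ^ a * [:Z$2$2, Z$1$2:] ^ b) k) \<in> BH_plus"
  unfolding BH_plus_def tfun_eq_coeff[symmetric]
  by (rule cfun.span_base) (use half_index_nat[OF assms(1)] assms(2,3) in blast)

lemma BH_minus_generator:
  assumes "k \<le> a + b" and "- 1 \<le> int (a + b) + j" and "int (a + b) + j \<le> 0"
  shows "on_GL (\<lambda>Z. det Z powi j *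
    poly.coeff ([:Z$2$1, Z$1$1:] ^ a * [:Z$2$2, Z$1$2:] ^ b) k) \<in> BH_minus"
proof -
  have "2 * (real (a + b) / 2) + of_int j = of_int (int (a + b) + j)"
    by simp
  then have "- 1 \<le> 2 * (real (a + b) / 2) + of_int j" "2 * (real (a + b) / 2) + of_int j \<le> 0"
    using assms(2,3) by linarith+
  then show ?thesis
    unfolding BH_minus_def tfun_eq_coeff[symmetric]
    by (intro cfun.span_base) (use half_index_nat[OF assms(1)] in blast)
qed

lemma subspace_BH: "cfun.subspace BH_plus" "cfun.subspace BH_minus"
  by (simp_all add: BH_plus_def BH_minus_def cfun.subspace_span)

lemma combination_in_subspace:
  assumes "cfun.subspace V" "on_GL g \<in> V" "on_GL h \<in> V"
  shows "on_GL (\<lambda>Z. c * g Z + d * h Z) \<in> V"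
  unfolding on_GL_combination
  by (intro cfun.subspace_add cfun.subspace_scale assms)

lemma coset_nontrivial:
  assumes "g \<notin> I0'"
  shows "g +o I0' \<noteq> I0'"
proof
  assume eq: "g +o I0' = I0'"
  have "0 \<in> I0'"
    by (auto simp: I0'_def on_GL_def fun_eq_iff intro!: exI[of _ 0])
  then have "g + 0 \<in> g +o I0'" by (rule set_plus_intro2)
  with eq assms show False by simp
qed

lemma on_GL_not_constant:
  fixes q :: "HC \<Rightarrow> complex"
  assumes "det Z \<noteq> 0" "det W \<noteq> 0" "q Z \<noteq> q W"
  shows "on_GL q \<notin> I0'"
  using assms by (auto simp: I0'_def on_GL_def fun_eq_iff) metis

text \<open>
  The quadratic \<open>z\<^sub>1\<^sub>2 z\<^sub>2\<^sub>1\<close> is not itself a generator: it has the same weight as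
  \<open>N = z\<^sub>1\<^sub>1 z\<^sub>2\<^sub>2 - z\<^sub>1\<^sub>2 z\<^sub>2\<^sub>1\<close> and as the function
  \<open>z\<^sub>1\<^sub>1 z\<^sub>2\<^sub>2 + z\<^sub>1\<^sub>2 z\<^sub>2\<^sub>1\<close> with \<open>l = 1\<close>, and is half their
  difference. The cubic is likewise obtained from a function with \<open>l = 3/2\<close> by
  subtracting a multiple of \<open>N z\<^sub>1\<^sub>1\<close>.
\<close>
lemma raised_vectors_in_BH_plus:
  "on_GL (\<lambda>Z. Z$2$2) \<in> BH_plus"
  "on_GL (\<lambda>Z. Z$1$2 * Z$2$1) \<in> BH_plus"
  "on_GL (\<lambda>Z. 2 * Z$1$1 * Z$1$2 * Z$2$1) \<in> BH_plus"
proof -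
  have z: "on_GL (\<lambda>Z. Z$2$2) \<in> BH_plus"
    using BH_plus_generator[of 0 0 1 0] by simp
  have zN: "on_GL (\<lambda>Z. det Z * Z$1$1) \<in> BH_plus"
    using BH_plus_generator[of 1 1 0 1] by simp
  have N: "on_GL (\<lambda>Z. det Z) \<in> BH_plus"
    using BH_plus_generator[of 0 0 0 1] by simp
  have t1: "on_GL (\<lambda>Z. Z$1$1 * Z$2$2 + Z$1$2 * Z$2$1) \<in> BH_plus"
    using BH_plus_generator[of 1 1 1 0] by (simp add: algebra_simps)
  have t3: "on_GL (\<lambda>Z. Z$1$1 * (Z$1$1 * Z$2$2) + 2 * (Z$1$1 * Z$1$2 * Z$2$1)) \<in> BH_plus"
    using BH_plus_generator[of 2 2 1 0]
    by (simp add: numeral_2_eq_2 algebra_simps)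
  show "on_GL (\<lambda>Z. Z$2$2) \<in> BH_plus" by (fact z)
  show "on_GL (\<lambda>Z. Z$1$2 * Z$2$1) \<in> BH_plus"
    using combination_in_subspace[OF subspace_BH(1) t1 N, of "1/2" "-1/2"]
    by (simp add: det_2 field_simps)
  show "on_GL (\<lambda>Z. 2 * Z$1$1 * Z$1$2 * Z$2$1) \<in> BH_plus"
    using combination_in_subspace[OF subspace_BH(1) t3 zN, of "2/3" "-2/3"]
    by (simp add: det_2 field_simps)
qed

text \<open>
  The inversion turns a function with index \<open>l\<close> into one with the same \<open>l\<close> divided by
  \<open>N\<^sup>2\<^sup>l\<close>. The decompositions are therefore those of the polynomial case with \<open>z\<^sub>1\<^sub>1\<close> and
  \<open>z\<^sub>2\<^sub>2\<close> exchanged, divided by the total degree's power of \<open>N\<close>.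
\<close>
lemma raised_vectors_in_BH_minus:
  "on_GL (\<lambda>Z. Z$1$1 / det Z) \<in> BH_minus"
  "on_GL (\<lambda>Z. Z$1$2 * Z$2$1 / det Z ^ 2) \<in> BH_minus"
  "on_GL (\<lambda>Z. 2 * Z$2$2 * Z$1$2 * Z$2$1 / det Z ^ 3) \<in> BH_minus"
proof -
  have z: "on_GL (\<lambda>Z. Z$1$1 / det Z) \<in> BH_minus"
    using BH_minus_generator[of 1 1 0 "- 1"] by (simp add: power_int_minus field_simps)
  have zN: "on_GL (\<lambda>Z. Z$2$2 / det Z ^ 2) \<in> BH_minus"
    using BH_minus_generator[of 0 0 1 "- 2"] by (simp add: power_int_minus field_simps)
  have N: "on_GL (\<lambda>Z. 1 / det Z) \<in> BH_minus"
    using BH_minus_generator[of 0 0 0 "- 1"] by (simp add: power_int_minus field_simps)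
  have t1: "on_GL (\<lambda>Z. (Z$1$1 * Z$2$2 + Z$1$2 * Z$2$1) / det Z ^ 2) \<in> BH_minus"
    using BH_minus_generator[of 1 1 1 "- 2"] by (simp add: power_int_minus field_simps)
  have t3: "on_GL (\<lambda>Z. (Z$1$1 * Z$2$2 * Z$2$2 + 2 * (Z$2$2 * Z$1$2 * Z$2$1)) / det Z ^ 3) \<in> BH_minus"
    using BH_minus_generator[of 1 1 2 "- 3"]
    by (simp add: numeral_2_eq_2 power_int_minus field_simps)
  show "on_GL (\<lambda>Z. Z$1$1 / det Z) \<in> BH_minus" by (fact z)
  \<comment> \<open>A linear relation between polynomials, divided by a power of \<open>n = N\<close>. One factor \<open>N\<close> of the
    last term cancels.\<close>
  have combine: "x / n ^ Suc k = c * (s / n ^ Suc k) + d * (y / n ^ k)"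
    if "x = c * s + d * (y * n)" and "n \<noteq> 0" for x n c s d y :: complex and k
    using that by (simp add: add_divide_distrib)
  have "on_GL (\<lambda>Z. Z$1$2 * Z$2$1 / det Z ^ 2) =
      on_GL (\<lambda>Z. 1/2 * ((Z$1$1 * Z$2$2 + Z$1$2 * Z$2$1) / det Z ^ 2) + - 1/2 * (1 / det Z))"
  proof (rule on_GL_cong)
    fix Z :: HC
    assume nz: "det Z \<noteq> 0"
    have "Z$1$2 * Z$2$1 = 1/2 * (Z$1$1 * Z$2$2 + Z$1$2 * Z$2$1) + - 1/2 * (1 * det Z)"
      by (simp add: det_2 field_simps)
    from combine[OF this nz, of "Suc 0"] show "Z$1$2 * Z$2$1 / det Z ^ 2 =
        1/2 * ((Z$1$1 * Z$2$2 + Z$1$2 * Z$2$1) / det Z ^ 2) + - 1/2 * (1 / det Z)"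
      by (simp only: power_Suc0_right flip: numeral_2_eq_2)
  qed
  then show "on_GL (\<lambda>Z. Z$1$2 * Z$2$1 / det Z ^ 2) \<in> BH_minus"
    by (simp only: combination_in_subspace[OF subspace_BH(2) t1 N])
  have "on_GL (\<lambda>Z. 2 * Z$2$2 * Z$1$2 * Z$2$1 / det Z ^ 3) =
      on_GL (\<lambda>Z. 2/3 * ((Z$1$1 * Z$2$2 * Z$2$2 + 2 * (Z$2$2 * Z$1$2 * Z$2$1)) / det Z ^ 3) +
        - 2/3 * (Z$2$2 / det Z ^ 2))"
  proof (rule on_GL_cong)
    fix Z :: HC
    assume nz: "det Z \<noteq> 0"
    have "2 * Z$2$2 * Z$1$2 * Z$2$1 =
        2/3 * (Z$1$1 * Z$2$2 * Z$2$2 + 2 * (Z$2$2 * Z$1$2 * Z$2$1)) + - 2/3 * (Z$2$2 * det Z)"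
      by (simp add: det_2 field_simps)
    from combine[OF this nz, of 2] show "2 * Z$2$2 * Z$1$2 * Z$2$1 / det Z ^ 3 =
        2/3 * ((Z$1$1 * Z$2$2 * Z$2$2 + 2 * (Z$2$2 * Z$1$2 * Z$2$1)) / det Z ^ 3) +
        - 2/3 * (Z$2$2 / det Z ^ 2)"
      by (simp only: Suc_numeral Num.add_num_simps)
  qed
  then show "on_GL (\<lambda>Z. 2 * Z$2$2 * Z$1$2 * Z$2$1 / det Z ^ 3) \<in> BH_minus"
    by (simp only: combination_in_subspace[OF subspace_BH(2) t3 zN])
qed

section \<open>Absence of unitary structures\<close>

theorem corollary13:
  "\<not> (\<exists>H. u22_unitary_structure_quot BH_plus I0' H) \<and>
   \<not> (\<exists>H. u22_unitary_structure_quot BH_minus I0' H)"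
proof -
  \<comment> \<open>An invertible matrix where the two raised functions take the value \<open>1\<close>, in contrast to \<open>0\<close> at
    the identity.\<close>
  define W :: HC where "W = (\<chi> i j. if i = j then 0 else 1)"
  have W: "det W = - 1" "W$1$2 = 1" "W$2$1 = 1"
    by (simp_all add: W_def det_2)
  have one: "(mat 1 :: HC)$1$2 = 0"
    by (simp add: mat_def)
  have "on_GL (\<lambda>Z. Z$1$2 * Z$2$1) +o I0' \<noteq> I0'"
    by (intro coset_nontrivial on_GL_not_constant[of "mat 1" W]) (simp_all add: W one)
  then have plus: "\<not> (\<exists>H. u22_unitary_structure_quot BH_plus I0' H)"
    using isotropic_raised_vector[OF _ subspace_BH(1) raised_vectors_in_BH_plus boost_in_u22[of 1] boost_in_u22[of \<i>],
        where e = "- \<i>"]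
    by (auto simp: rho'_boost_plus)
  have "on_GL (\<lambda>Z. Z$1$2 * Z$2$1 / det Z ^ 2) +o I0' \<noteq> I0'"
    by (intro coset_nontrivial on_GL_not_constant[of "mat 1" W]) (simp_all add: W one)
  then have minus: "\<not> (\<exists>H. u22_unitary_structure_quot BH_minus I0' H)"
    using isotropic_raised_vector[OF _ subspace_BH(2) raised_vectors_in_BH_minus boost_in_u22[of 1] boost_in_u22[of \<i>],
        where e = "\<i>"]
    by (auto simp: rho'_boost_minus)
  from plus minus show ?thesis by blast
qed

end
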